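(* Let $(\gamma_n)_{n\in\mathbb{N}}$ and $(\delta_n)_{n\in\mathbb{N}}$ be sequences of independent random variables, each uniformly distributed (with respect to Lebesgue measure) in $[0,1)$. Then almost surely the following holds: for all $\alpha,\beta\in\mathbb{R}$, \[\liminf_{n\to\infty} n(\log n)\,\|n\alpha-\gamma_n\|\,\|n\beta-\delta_n\|\le 1.\]
   Context: For $x\in\mathbb{R}$, $\|x\|$ denotes the distance from $x$ to the nearest integer. The random variables $\gamma_1,\gamma_2,\dots,\delta_1,\delta_2,\dots$ are all mutually independent. *)

theory Defs
  imports "HOL-Probability.Probability"
begin

definition nint_dist :: "real \<Rightarrow> real" where
  "nint_dist x = infdist x \<int>"

end

theory Submission
  imports Defs "HOL-Real_Asymp.Real_Asymp"
begin

text \<open>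
  For fixed \<open>\<alpha>, \<beta>\<close> the two distances are independent and uniform on \<open>[0, 1/2]\<close>, so their product is at
  most \<open>t\<close> with probability at least \<open>4 t ln (1 / (4 t))\<close>; for \<open>t = c / (n ln n)\<close> this is at least
  \<open>4 c / n\<close>. By independence in \<open>n\<close>, the probability that no \<open>n\<close> in \<open>[N, m]\<close> achieves this is at most
  \<open>(N / (m + 1)) powr (4 c)\<close>. Moving \<open>\<alpha>, \<beta>\<close> by \<open>m powr -(2 + s)\<close> changes \<open>n ln n\<close> times the product by
  \<open>o(1)\<close> uniformly in \<open>n \<le> m\<close>, so it suffices to control a grid of about \<open>m powr (4 + 2 s)\<close> points of the
  unit square. For \<open>c = 1 + s\<close> the union bound over this grid tends to \<open>0\<close> as \<open>m\<close> grows, which is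
  exactly where the constant \<open>1\<close> comes from.
\<close>

section \<open>Distance to the nearest integer\<close>

lemma nint_dist_le_iff: "nint_dist x \<le> r \<longleftrightarrow> (\<exists>k::int. \<bar>x - k\<bar> \<le> r)"
proof
  \<comment> \<open>The infimum over the integers is attained at \<open>round x\<close>, so a
    witness exists even for \<open>r\<close> equal to the distance.\<close>
  have "\<bar>x - round x\<bar> \<le> nint_dist x"
    unfolding nint_dist_def infdist_def
    by (auto intro!: cINF_greatest simp: dist_real_def round_diff_minimal elim!: Ints_cases)
  then show "nint_dist x \<le> r \<Longrightarrow> \<exists>k::int. \<bar>x - k\<bar> \<le> r"
    by (intro exI[of _ "round x"]) linarith
next
  assume "\<exists>k::int. \<bar>x - k\<bar> \<le> r"
  then obtain k :: int where "\<bar>x - k\<bar> \<le> r" ..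
  then show "nint_dist x \<le> r"
    unfolding nint_dist_def by (intro infdist_le2[of "of_int k"]) (auto simp: dist_real_def)
qed

lemma nint_dist_nonneg [simp]: "0 \<le> nint_dist x"
  by (simp add: nint_dist_def infdist_nonneg)

lemma nint_dist_le_half: "nint_dist x \<le> 1 / 2"
  unfolding nint_dist_le_iff using of_int_round_abs_le[of x] abs_minus_commute[of x]
  by (intro exI[of _ "round x"]) simp

lemma nint_dist_triangle: "nint_dist x \<le> nint_dist y + \<bar>x - y\<bar>"
  using infdist_triangle[of x \<int> y] by (simp add: nint_dist_def dist_real_def)

lemma nint_dist_add_int [simp]: "nint_dist (x + of_int k) = nint_dist x"
proof -
  have "nint_dist (x + of_int k) \<le> r \<longleftrightarrow> nint_dist x \<le> r" for r
    unfolding nint_dist_le_iff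
  proof safe
    fix j :: int assume "\<bar>x + of_int k - of_int j\<bar> \<le> r"
    then show "\<exists>k::int. \<bar>x - of_int k\<bar> \<le> r" by (intro exI[of _ "j - k"]) (simp add: algebra_simps)
  next
    fix j :: int assume "\<bar>x - of_int j\<bar> \<le> r"
    then show "\<exists>j::int. \<bar>x + of_int k - of_int j\<bar> \<le> r"
      by (intro exI[of _ "j + k"]) (simp add: algebra_simps)
  qed
  then show ?thesis by (meson order.refl order.antisym)
qed

lemma measurable_nint_dist [measurable]: "nint_dist \<in> borel_measurable borel"
  unfolding nint_dist_def by (intro borel_measurable_continuous_onI continuous_intros)

section \<open>Law of the distance under a uniform shift\<close>

lemma measure_nint_dist_le:
  assumes "0 \<le> r" "r < 1 / 2"
  shows "measure lborel ({0..<1} \<inter> {u. nint_dist (a - u) \<le> r}) = 2 * r"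
proof -
  define b where "b = frac a"
  have b: "0 \<le> b" "b < 1" by (simp_all add: b_def frac_lt_1)
  have "a - u = (b - u) + of_int \<lfloor>a\<rfloor>" for u by (simp add: b_def frac_def)
  then have nd: "nint_dist (a - u) = nint_dist (b - u)" for u
    by (metis nint_dist_add_int)
  \<comment> \<open>Both \<open>b\<close> and \<open>u\<close> lie in \<open>[0, 1)\<close> and
    \<open>r < 1/2\<close>, so only the integers -1, 0 and 1 can be within \<open>r\<close> of
    \<open>b - u\<close>.\<close>
  have nd': "nint_dist (b - u) \<le> r \<longleftrightarrow> \<bar>b - u\<bar> \<le> r \<or> \<bar>b - u - 1\<bar> \<le> r \<or> \<bar>b - u + 1\<bar> \<le> r"
    if "0 \<le> u" "u < 1" for u
  proof
    assume "nint_dist (b - u) \<le> r"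
    then obtain k :: int where k: "\<bar>b - u - k\<bar> \<le> r" by (auto simp: nint_dist_le_iff)
    then have "real_of_int k < 2" "real_of_int k > - 2" using b that assms by linarith+
    then have "k = 0 \<or> k = 1 \<or> k = -1" by auto
    with k show "\<bar>b - u\<bar> \<le> r \<or> \<bar>b - u - 1\<bar> \<le> r \<or> \<bar>b - u + 1\<bar> \<le> r" by auto
  next
    assume "\<bar>b - u\<bar> \<le> r \<or> \<bar>b - u - 1\<bar> \<le> r \<or> \<bar>b - u + 1\<bar> \<le> r"
    then show "nint_dist (b - u) \<le> r"
      unfolding nint_dist_le_iff by (elim disjE; force intro: exI[of _ 0] exI[of _ 1] exI[of _ "-1"])
  qed
  let ?S = "{0..<1} \<inter> {u. nint_dist (a - u) \<le> r}"
  \<comment> \<open>On the circle the set is an arc of length \<open>2 * r\<close> centred at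
    \<open>b\<close>. It wraps around at 0, stays a single interval, or wraps around at 1; when it
    wraps, \<open>2 * r < 1\<close> keeps the two pieces disjoint.\<close>
  consider "b < r" | "r \<le> b" "b < 1 - r" | "1 - r \<le> b" by linarith
  then show ?thesis
  proof cases
    case 1
    have "?S = {0..b + r} \<union> {b + 1 - r..<1}"
      using 1 b assms by (auto simp: nd nd')
    moreover have "measure lborel ({0..b + r} \<union> {b + 1 - r..<1}) = (b + r) + (r - b)"
      using 1 b assms by (subst measure_Union) auto
    ultimately show ?thesis by simp
  next
    case 2
    have "?S = {b - r..b + r}"
      using 2 b assms by (auto simp: nd nd')
    then show ?thesis using assms by simp
  next
    case 3
    have "?S = {0..b - 1 + r} \<union> {b - r..<1}"
      using 3 b assms by (auto simp: nd nd')
    moreover have "measure lborel ({0..b - 1 + r} \<union> {b - r..<1}) = (b - 1 + r) + (1 - b + r)"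
      using 3 b assms by (subst measure_Union) auto
    ultimately show ?thesis by simp
  qed
qed

text \<open>Rotation invariance makes the law independent of \<open>a\<close>. The distribution
  functions agree: both are 0 below 0, \<open>2 * r\<close> on \<open>[0, 1/2)\<close>, and 1 from
  1/2 on.\<close>

lemma distr_nint_dist_uniform:
  "distr (uniform_measure lborel {0..<1}) borel (\<lambda>u. nint_dist (a - u)) =
    uniform_measure lborel {0..1/2}" (is "?L = ?R")
proof (rule cdf_unique)
  interpret U: prob_space "uniform_measure lborel {0..<1::real}"
    by (rule prob_space_uniform_measure) auto
  show "real_distribution ?L" by (intro U.real_distribution_distr) measurable
  show "real_distribution ?R"
    unfolding real_distribution_def real_distribution_axioms_def
    by (auto intro!: prob_space_uniform_measure)
  show "cdf ?L = cdf ?R"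
  proof
    fix r
    have L: "cdf ?L r = measure lborel ({0..<1} \<inter> {u. nint_dist (a - u) \<le> r})"
      unfolding cdf_def2 by (subst measure_distr) (auto simp: vimage_def)
    have R: "cdf ?R r = 2 * measure lborel ({0..1/2} \<inter> {..r})"
      unfolding cdf_def2 by simp
    consider "r < 0" | "0 \<le> r" "r < 1/2" | "1/2 \<le> r" by linarith
    then show "cdf ?L r = cdf ?R r"
    proof cases
      case 1
      have "{u. nint_dist (a - u) \<le> r} = {}"
        using 1 nint_dist_nonneg by (auto simp: not_le intro: less_le_trans)
      moreover have "{0..1/2} \<inter> {..r} = {}" using 1 by auto
      ultimately show ?thesis unfolding L R by simp
    next
      case 2
      have "{0..1/2} \<inter> {..r} = {0..r}" using 2 by auto
      then show ?thesis unfolding L R using 2 by (simp add: measure_nint_dist_le)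
    next
      case 3
      have "{u. nint_dist (a - u) \<le> r} = UNIV"
        using order_trans[OF nint_dist_le_half 3] by auto
      moreover have "{0..1/2} \<inter> {..r} = {0..1/2}" using 3 by auto
      ultimately show ?thesis unfolding L R by simp
    qed
  qed
qed

text \<open>The slice at \<open>x\<close> in \<open>[2 * t, 1/2]\<close> has probability
  \<open>2 * t / x\<close>; integrating this against the density 2 gives the logarithm. Slices with
  \<open>x < 2 * t\<close> have full probability and would add only \<open>4 * t\<close>, so they
  are discarded.\<close>

lemma uniform_product_le:
  fixes t :: real
  assumes "0 < t" "t \<le> 1 / 4"
  defines "U \<equiv> uniform_measure lborel {0..1/2}"
  shows "measure (U \<Otimes>\<^sub>M U) {p. fst p * snd p \<le> t} \<ge> 4 * t * ln (1 / (4 * t))"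
proof -
  interpret U: prob_space U
    unfolding U_def by (rule prob_space_uniform_measure) auto
  interpret UU: pair_prob_space U U ..
  have setsU [measurable_cong]: "sets U = sets borel" by (simp add: U_def)
  have S: "{p. fst p * snd p \<le> t} \<in> sets (U \<Otimes>\<^sub>M U)"
  proof -
    have "{p \<in> space (U \<Otimes>\<^sub>M U). fst p * snd p \<le> t} \<in> sets (U \<Otimes>\<^sub>M U)" by measurable
    then show ?thesis by (simp add: space_pair_measure U_def)
  qed
  have slice: "emeasure U {y. x * y \<le> t} \<ge> ennreal (2 * t / x)" if "x \<in> {2 * t..1/2}" for x
  proof -
    have x: "0 < x" "t / x \<le> 1 / 2" using that assms by (auto simp: field_simps)
    have "{y. x * y \<le> t} = {..t/x}" using x by (auto simp: field_simps)
    then have "{0..1/2} \<inter> {y. x * y \<le> t} = {0..t/x}" using x by auto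
    moreover have "{y. x * y \<le> t} \<in> sets lborel" by measurable
    ultimately have "emeasure U {y. x * y \<le> t} = ennreal (t / x) / ennreal (1 / 2)"
      using x assms unfolding U_def by (subst emeasure_uniform_measure) auto
    also have "\<dots> = ennreal (2 * t / x)"
      using x assms by (subst divide_ennreal) auto
    finally show ?thesis by simp
  qed
  \<comment> \<open>The value is rewritten as the increment of the antiderivative
    \<open>2 * t * ln x\<close> over \<open>[2 * t, 1/2]\<close>; division by 1/2 is the
    normalisation of \<open>U\<close>.\<close>
  have "ennreal (4 * t * ln (1 / (4 * t))) = ennreal (2 * t * ln (1 / 2) - 2 * t * ln (2 * t)) / ennreal (1 / 2)"
  proof -
    have eq: "ln (1 / (4 * t)) = ln (1 / 2) - ln (2 * t)"
      using assms by (subst ln_divide_pos[symmetric]) auto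
    have "0 \<le> 2 * t * (ln (1 / 2) - ln (2 * t))"
      unfolding eq[symmetric] using assms by simp
    then show ?thesis unfolding eq by (subst divide_ennreal) (auto simp: right_diff_distrib)
  qed
  also have "ennreal (2 * t * ln (1 / 2) - 2 * t * ln (2 * t)) =
      (\<integral>\<^sup>+x. ennreal (2 * t / x) * indicator {2 * t..1/2} x \<partial>lborel)"
    using assms
    by (intro nn_integral_FTC_Icc[symmetric]) (auto intro!: derivative_eq_intros)
  also have "\<dots> \<le> (\<integral>\<^sup>+x. emeasure U {y. x * y \<le> t} * indicator {0..1/2} x \<partial>lborel)"
    using slice assms by (intro nn_integral_mono) (auto split: split_indicator)
  also have "\<dots> / ennreal (1 / 2) = (\<integral>\<^sup>+x. emeasure U {y. x * y \<le> t} \<partial>U)"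
  proof -
    have "(\<lambda>x. emeasure U (Pair x -` {p. fst p * snd p \<le> t})) \<in> borel_measurable U"
      by (rule U.measurable_emeasure_Pair[OF S])
    then have "(\<lambda>x. emeasure U {y. x * y \<le> t}) \<in> borel_measurable lborel"
      by (simp add: vimage_def U_def)
    then show ?thesis
      by (subst U_def, subst (2) U_def) (subst nn_integral_uniform_measure, auto simp: U_def)
  qed
  also have "\<dots> = emeasure (U \<Otimes>\<^sub>M U) {p. fst p * snd p \<le> t}"
    by (subst U.emeasure_pair_measure_alt[OF S]) (simp add: vimage_def)
  finally show ?thesis
    by (simp add: UU.emeasure_eq_measure divide_right_mono_ennreal)
qed

section \<open>Grid approximation and a telescoping product\<close>

lemma grid_approx:
  fixes \<alpha> :: real
  assumes "0 < K"
  obtains i :: nat and k :: int where "i < K" "\<bar>\<alpha> - real_of_int k - real i / real K\<bar> \<le> 1 / real K"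
proof
  let ?i = "nat \<lfloor>real K * frac \<alpha>\<rfloor>"
  have "real K * frac \<alpha> < real K" using assms frac_lt_1[of \<alpha>] by simp
  moreover have ge: "0 \<le> \<lfloor>real K * frac \<alpha>\<rfloor>" by simp
  ultimately show "?i < K" by linarith
  have "real ?i = of_int \<lfloor>real K * frac \<alpha>\<rfloor>" using ge by simp
  then have "\<bar>real K * frac \<alpha> - real ?i\<bar> \<le> 1" by linarith
  moreover have "\<alpha> - real_of_int \<lfloor>\<alpha>\<rfloor> - real ?i / real K = (real K * frac \<alpha> - real ?i) / real K"
    using assms by (simp add: frac_def field_simps)
  ultimately show "\<bar>\<alpha> - real_of_int \<lfloor>\<alpha>\<rfloor> - real ?i / real K\<bar> \<le> 1 / real K"
    by (simp add: abs_divide divide_right_mono)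
qed

text \<open>The integer \<open>k\<close> contributes the integer \<open>n * k\<close>, which the
  distance ignores, and the remaining error is amplified by at most \<open>m\<close>. Hence one grid
  serves all \<open>n \<le> m\<close> simultaneously.\<close>

lemma nint_dist_multiple_le:
  assumes "\<bar>\<alpha> - real_of_int k - a\<bar> \<le> \<epsilon>" "n \<le> m"
  shows "nint_dist (real n * \<alpha> - g) \<le> nint_dist (real n * a - g) + real m * \<epsilon>"
proof -
  have "nint_dist (real n * \<alpha> - g) = nint_dist ((real n * (\<alpha> - k) - g) + of_int (int n * k))"
    by (simp add: algebra_simps)
  also have "\<dots> = nint_dist (real n * (\<alpha> - k) - g)"
    by (rule nint_dist_add_int)
  also have "\<dots> \<le> nint_dist (real n * a - g) + \<bar>real n * (\<alpha> - k - a)\<bar>"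
    using nint_dist_triangle[of "real n * (\<alpha> - k) - g" "real n * a - g"] by (simp add: algebra_simps)
  also have "\<bar>real n * (\<alpha> - k - a)\<bar> \<le> real m * \<epsilon>"
    using assms unfolding abs_mult by (intro mult_mono) auto
  finally show ?thesis by simp
qed

text \<open>Telescoping; this is how the single-index bounds combine into a power of
  \<open>N / (m + 1)\<close>.\<close>

lemma prod_ratio_powr:
  assumes "N \<le> m" "1 \<le> N"
  shows "(\<Prod>n=N..m. (real n / real (n + 1)) powr p) = (real N / real (m + 1)) powr p"
  using assms(1)
proof (induction m rule: dec_induct)
  case base
  then show ?case by simp
next
  case (step m)
  have "(\<Prod>n=N..Suc m. (real n / real (n + 1)) powr p) =
      (real N / real (m + 1)) powr p * (real (Suc m) / real (Suc m + 1)) powr p"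
    using step by (simp add: prod.cl_ivl_Suc)
  also have "\<dots> = (real N / real (m + 1) * (real (Suc m) / real (Suc m + 1))) powr p"
    by (subst powr_mult) auto
  finally show ?case by simp
qed

text \<open>Merging both sequences into one family over a disjoint sum makes
  \<open>indep_vars\<close> express mutual independence across the sequences as well as within each.
  Indices start at 1, so nothing is assumed about index 0.\<close>

locale uniform_shifts = prob_space M for M :: "'a measure" +
  fixes \<gamma> \<delta> :: "nat \<Rightarrow> 'a \<Rightarrow> real"
  assumes indep: "indep_vars (\<lambda>_. borel) (case_sum \<gamma> \<delta>) ({1..} <+> {1..})"
    and distr_\<gamma>: "\<And>n. n \<ge> 1 \<Longrightarrow> distr M borel (\<gamma> n) = uniform_measure lborel {0..<1}"
    and distr_\<delta>: "\<And>n. n \<ge> 1 \<Longrightarrow> distr M borel (\<delta> n) = uniform_measure lborel {0..<1}"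
begin

section \<open>Probability estimates for a fixed pair of reals\<close>

definition prod_dist :: "real \<Rightarrow> real \<Rightarrow> nat \<Rightarrow> 'a \<Rightarrow> real" where
  "prod_dist a b n \<omega> = nint_dist (real n * a - \<gamma> n \<omega>) * nint_dist (real n * b - \<delta> n \<omega>)"

lemma random_variable_shifts:
  assumes "1 \<le> n"
  shows "\<gamma> n \<in> borel_measurable M" "\<delta> n \<in> borel_measurable M"
proof -
  have "\<forall>i \<in> {1..} <+> {1..}. case_sum \<gamma> \<delta> i \<in> borel_measurable M"
    using indep unfolding indep_vars_def by simp
  from bspec[OF this, of "Inl n"] bspec[OF this, of "Inr n"] assms
  show "\<gamma> n \<in> borel_measurable M" "\<delta> n \<in> borel_measurable M" by auto
qed

lemma measurable_prod_dist:
  assumes "1 \<le> n"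
  shows "prod_dist a b n \<in> borel_measurable M"
proof -
  note [measurable] = random_variable_shifts[OF assms]
  show ?thesis unfolding prod_dist_def by measurable
qed

text \<open>The blocks \<open>{Inl n, Inr n}\<close> are pairwise disjoint and each product is a
  measurable function of its own block, so independence passes to the products.\<close>

lemma indep_vars_prod_dist: "indep_vars (\<lambda>_. borel) (prod_dist a b) {1..}"
proof -
  let ?K = "\<lambda>n::nat. {Inl n, Inr n}"
  let ?Y = "\<lambda>n f. nint_dist (real n * a - f (Inl n)) * nint_dist (real n * b - f (Inr n))"
  have "indep_vars (\<lambda>n. PiM (?K n) (\<lambda>_. borel))
      (\<lambda>n \<omega>. restrict (\<lambda>i. case_sum \<gamma> \<delta> i \<omega>) (?K n)) {1..}"
    by (rule indep_vars_restrict[OF indep]) (auto simp: disjoint_family_on_def)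
  then have "indep_vars (\<lambda>_. borel)
      (\<lambda>n \<omega>. ?Y n (restrict (\<lambda>i. case_sum \<gamma> \<delta> i \<omega>) (?K n))) {1..}"
    by (rule indep_vars_compose2) measurable
  then show ?thesis
    by (simp add: prod_dist_def[abs_def])
qed

text \<open>The two distances depend on the separate blocks \<open>{Inl n}\<close> and
  \<open>{Inr n}\<close>, so the joint law is the product of the marginals. This reduces the
  probability to the area estimate \<open>uniform_product_le\<close>.\<close>

lemma distr_dist_pair:
  fixes a b :: real
  assumes "1 \<le> n"
  shows "distr M (borel \<Otimes>\<^sub>M borel)
      (\<lambda>\<omega>. (nint_dist (a - \<gamma> n \<omega>), nint_dist (b - \<delta> n \<omega>))) =
    uniform_measure lborel {0..1/2} \<Otimes>\<^sub>M uniform_measure lborel {0..1/2}"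
proof -
  note [measurable] = random_variable_shifts[OF assms]
  have "indep_var (PiM {Inl n} (\<lambda>_. borel)) (\<lambda>\<omega>. restrict (\<lambda>i. case_sum \<gamma> \<delta> i \<omega>) {Inl n})
      (PiM {Inr n} (\<lambda>_. borel)) (\<lambda>\<omega>. restrict (\<lambda>i. case_sum \<gamma> \<delta> i \<omega>) {Inr n})"
    using assms by (intro indep_var_restrict[OF indep]) auto
  then have "indep_var borel ((\<lambda>f. nint_dist (a - f (Inl n))) \<circ> (\<lambda>\<omega>. restrict (\<lambda>i. case_sum \<gamma> \<delta> i \<omega>) {Inl n}))
      borel ((\<lambda>f. nint_dist (b - f (Inr n))) \<circ> (\<lambda>\<omega>. restrict (\<lambda>i. case_sum \<gamma> \<delta> i \<omega>) {Inr n}))"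
    by (rule indep_var_compose) measurable
  then have "indep_var borel (\<lambda>\<omega>. nint_dist (a - \<gamma> n \<omega>)) borel (\<lambda>\<omega>. nint_dist (b - \<delta> n \<omega>))"
    by (simp add: comp_def)
  then have "distr M (borel \<Otimes>\<^sub>M borel) (\<lambda>\<omega>. (nint_dist (a - \<gamma> n \<omega>), nint_dist (b - \<delta> n \<omega>))) =
      distr M borel (\<lambda>\<omega>. nint_dist (a - \<gamma> n \<omega>)) \<Otimes>\<^sub>M distr M borel (\<lambda>\<omega>. nint_dist (b - \<delta> n \<omega>))"
    by (simp add: indep_var_distribution_eq)
  also have "distr M borel (\<lambda>\<omega>. nint_dist (a - \<gamma> n \<omega>)) = uniform_measure lborel {0..1/2}"
    using distr_distr[of "\<lambda>u. nint_dist (a - u)" borel borel "\<gamma> n" M] distr_\<gamma>[OF assms]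
    by (simp add: comp_def distr_nint_dist_uniform)
  also have "distr M borel (\<lambda>\<omega>. nint_dist (b - \<delta> n \<omega>)) = uniform_measure lborel {0..1/2}"
    using distr_distr[of "\<lambda>u. nint_dist (b - u)" borel borel "\<delta> n" M] distr_\<delta>[OF assms]
    by (simp add: comp_def distr_nint_dist_uniform)
  finally show ?thesis .
qed

lemma prob_prod_dist_le:
  assumes "1 \<le> n" "0 < t" "t \<le> 1 / 4"
  shows "4 * t * ln (1 / (4 * t)) \<le> prob {\<omega> \<in> space M. prod_dist a b n \<omega> \<le> t}"
proof -
  note [measurable] = random_variable_shifts[OF assms(1)]
  let ?Z = "\<lambda>\<omega>. (nint_dist (real n * a - \<gamma> n \<omega>), nint_dist (real n * b - \<delta> n \<omega>))"
  have [measurable]: "{p :: real \<times> real. fst p * snd p \<le> t} \<in> sets (borel \<Otimes>\<^sub>M borel)"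
  proof -
    have "{p \<in> space (borel \<Otimes>\<^sub>M borel :: (real \<times> real) measure). fst p * snd p \<le> t} \<in> sets (borel \<Otimes>\<^sub>M borel)"
      by measurable
    then show ?thesis by (simp add: space_pair_measure)
  qed
  have "4 * t * ln (1 / (4 * t)) \<le> measure (distr M (borel \<Otimes>\<^sub>M borel) ?Z) {p. fst p * snd p \<le> t}"
    unfolding distr_dist_pair[OF assms(1)] by (rule uniform_product_le) fact+
  also have "\<dots> = prob {\<omega> \<in> space M. prod_dist a b n \<omega> \<le> t}"
    by (subst measure_distr) (auto simp: prod_dist_def intro!: arg_cong[where f=prob])
  finally show ?thesis .
qed

text \<open>For \<open>t = c / (n * ln n)\<close> the hypothesis on \<open>c\<close> gives both
  \<open>t \<le> 1/4\<close> and \<open>1 / (4 * t) \<ge> n\<close>. The logarithm from the area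
  estimate therefore cancels \<open>ln n\<close>, and the complementary event has probability at
  least \<open>4 * c / n\<close>. Finally \<open>1 - x \<le> exp (- x)\<close> and
  \<open>ln (1 + 1/n) \<le> 1/n\<close> put the bound into a form that telescopes.\<close>

lemma prob_prod_dist_gt:
  assumes "1 \<le> n" "0 < c" "4 * c \<le> ln (real n)"
  shows "prob {\<omega> \<in> space M. c / (real n * ln (real n)) < prod_dist a b n \<omega>}
    \<le> (real n / real (n + 1)) powr (4 * c)"
proof -
  note [measurable] = measurable_prod_dist[OF assms(1)]
  define t where "t = c / (real n * ln (real n))"
  have ln: "0 < ln (real n)" using assms by linarith
  have t: "0 < t" "t \<le> 1 / 4"
  proof -
    show "0 < t" using ln assms by (simp add: t_def)
    have "1 * ln (real n) \<le> real n * ln (real n)"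
      using assms(1) ln by (intro mult_right_mono) auto
    then have "4 * c \<le> real n * ln (real n)" using assms(3) by linarith
    then show "t \<le> 1 / 4" using ln assms by (simp add: t_def field_simps)
  qed
  have "4 * c / real n = 4 * t * ln (real n)"
    using ln assms by (simp add: t_def)
  also have "\<dots> \<le> 4 * t * ln (1 / (4 * t))"
  proof -
    have "real n \<le> real n * (ln (real n) / (4 * c))"
      using assms by (simp add: field_simps)
    also have "\<dots> = 1 / (4 * t)" by (simp add: t_def)
    finally have "ln (real n) \<le> ln (1 / (4 * t))" using assms t by (subst ln_le_cancel_iff) auto
    then show ?thesis using t by simp
  qed
  also have "\<dots> \<le> prob {\<omega> \<in> space M. prod_dist a b n \<omega> \<le> t}"
    by (rule prob_prod_dist_le) fact+
  also have "\<dots> = 1 - prob {\<omega> \<in> space M. t < prod_dist a b n \<omega>}"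
    by (subst prob_compl[symmetric]) (auto intro!: arg_cong[where f=prob])
  finally have "prob {\<omega> \<in> space M. t < prod_dist a b n \<omega>} \<le> 1 + - (4 * c / real n)" by simp
  also have "\<dots> \<le> exp (- (4 * c / real n))" by (rule exp_ge_add_one_self)
  also have "\<dots> \<le> exp (- (4 * c * ln (1 + 1 / real n)))"
    using assms ln_add_one_self_le_self[of "1 / real n"] by (simp add: field_simps)
  also have "\<dots> = (real n / real (n + 1)) powr (4 * c)"
  proof -
    have "1 + 1 / real n = real (n + 1) / real n" using assms by (simp add: field_simps)
    then have "- ln (1 + 1 / real n) = ln (real n / real (n + 1))"
      using assms by (simp add: ln_div)
    then show ?thesis using assms by (simp add: powr_def flip: mult_minus_right)
  qed
  finally show ?thesis by (simp add: t_def)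
qed

text \<open>Independence turns the intersection into a product of single-index bounds, which
  telescopes. The condition on \<open>N\<close> carries over to every \<open>n \<ge> N\<close> by
  monotonicity of the logarithm.\<close>

lemma prob_all_prod_dist_gt:
  assumes "1 \<le> N" "N \<le> m" "0 < c" "4 * c \<le> ln (real N)"
  shows "prob (\<Inter>n\<in>{N..m}. {\<omega> \<in> space M. c / (real n * ln (real n)) < prod_dist a b n \<omega>})
    \<le> (real N / real (m + 1)) powr (4 * c)"
proof -
  have eq: "{\<omega> \<in> space M. c / (real n * ln (real n)) < prod_dist a b n \<omega>} =
      prod_dist a b n -` {c / (real n * ln (real n))<..} \<inter> space M" for n by auto
  have "prob (\<Inter>n\<in>{N..m}. {\<omega> \<in> space M. c / (real n * ln (real n)) < prod_dist a b n \<omega>}) =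
      (\<Prod>n=N..m. prob {\<omega> \<in> space M. c / (real n * ln (real n)) < prod_dist a b n \<omega>})"
    unfolding eq using assms by (intro indep_varsD[OF indep_vars_prod_dist]) auto
  also have "\<dots> \<le> (\<Prod>n=N..m. (real n / real (n + 1)) powr (4 * c))"
  proof (intro prod_mono conjI prob_prod_dist_gt)
    fix n assume n: "n \<in> {N..m}"
    then have "ln (real N) \<le> ln (real n)" using assms by simp
    then show "4 * c \<le> ln (real n)" using assms by linarith
  qed (use assms in auto)
  also have "\<dots> = (real N / real (m + 1)) powr (4 * c)"
    by (rule prod_ratio_powr) fact+
  finally show ?thesis .
qed

section \<open>Union bound over the grid\<close>

lemma AE_no_uniformly_bad_pair:
  assumes "0 < s" "1 \<le> N" "4 * (1 + s) \<le> ln (real N)"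
  shows "AE \<omega> in M. \<not> (\<exists>\<alpha> \<beta>. \<forall>n\<ge>N. 1 + 2 * s < real n * ln (real n) * prod_dist \<alpha> \<beta> n \<omega>)"
proof -
  \<comment> \<open>The grid error, scaled by \<open>n * ln n\<close>, is of order at most
    \<open>m * ln m * (m / K m)\<close>; any exponent above 2 makes it vanish.\<close>
  define K where "K m = nat \<lceil>real m powr (2 + s)\<rceil>" for m :: nat
  \<comment> \<open>The threshold is \<open>1 + s\<close> instead of \<open>1 + 2 * s\<close>; the
    gap \<open>s\<close> absorbs the error of moving to a grid point.\<close>
  define G where "G a b n = {\<omega> \<in> space M. (1 + s) / (real n * ln (real n)) < prod_dist a b n \<omega>}" for a b n
  define A where "A m = (\<Union>(i, j)\<in>{..<K m} \<times> {..<K m}.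
    \<Inter>n\<in>{N..m}. G (real i / real (K m)) (real j / real (K m)) n)" for m
  have lnN: "0 < ln (real N)" using assms(1) by (intro less_le_trans[OF _ assms(3)]) simp
  have G_sets: "G a b n \<in> events" if "N \<le> n" for a b n
    using measurable_prod_dist[of n a b] that assms unfolding G_def by simp
  then have inter_sets: "(\<Inter>n\<in>{N..m}. G a b n) \<in> events" if "N \<le> m" for a b m
    using that by (intro sets.finite_INT) auto
  then have A_sets: "A m \<in> events" if "N \<le> m" for m
    using that unfolding A_def by (intro sets.finite_UN) auto

  have prob_A: "prob (A m) \<le> (real m powr (2 + s) + 1)\<^sup>2 * (real N / real (m + 1)) powr (4 * (1 + s))"
    if "N \<le> m" for m
  proof -
    have "prob (A m) \<le> (\<Sum>(i, j)\<in>{..<K m} \<times> {..<K m}.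
        prob (\<Inter>n\<in>{N..m}. G (real i / real (K m)) (real j / real (K m)) n))"
      unfolding A_def case_prod_unfold using inter_sets[OF that]
      by (intro finite_measure_subadditive_finite) auto
    also have "\<dots> \<le> (\<Sum>(i, j)\<in>{..<K m} \<times> {..<K m}. (real N / real (m + 1)) powr (4 * (1 + s)))"
      unfolding G_def case_prod_unfold using assms that
      by (intro sum_mono prob_all_prod_dist_gt) auto
    also have "\<dots> = (real (K m))\<^sup>2 * (real N / real (m + 1)) powr (4 * (1 + s))"
      by (simp add: power2_eq_square)
    also have "\<dots> \<le> (real m powr (2 + s) + 1)\<^sup>2 * (real N / real (m + 1)) powr (4 * (1 + s))"
    proof -
      have "0 \<le> real m powr (2 + s)" by simp
      then have "real (K m) \<le> real m powr (2 + s) + 1" unfolding K_def by linarith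
      then show ?thesis by (intro mult_right_mono power_mono) auto
    qed
    finally show ?thesis .
  qed

  \<comment> \<open>The number of grid points grows like \<open>m powr (4 + 2 * s)\<close>, while
    the probability at each decays like \<open>m powr -(4 + 4 * s)\<close>.\<close>
  have "(\<lambda>m. (real m powr (2 + s) + 1)\<^sup>2 * (real N / real (m + 1)) powr (4 * (1 + s))) \<longlonglongrightarrow> 0"
    using assms by real_asymp
  moreover have "\<forall>\<^sub>F m in sequentially. norm (prob (A m)) \<le>
      (real m powr (2 + s) + 1)\<^sup>2 * (real N / real (m + 1)) powr (4 * (1 + s))"
    using eventually_ge_at_top[of N] by eventually_elim (simp only: real_norm_def abs_of_nonneg measure_nonneg prob_A)
  ultimately have lim_A: "(\<lambda>m. prob (A m)) \<longlonglongrightarrow> 0"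
    by (rule Lim_null_comparison[rotated])

  have "(\<lambda>m. 2 * real m * ln (real m) * (real m / real m powr (2 + s))) \<longlonglongrightarrow> 0"
    using assms by real_asymp
  then have "\<forall>\<^sub>F m in sequentially. 2 * real m * ln (real m) * (real m / real m powr (2 + s)) < s"
    using assms by (intro order_tendstoD)
  then have "\<forall>\<^sub>F m in sequentially. N \<le> m \<and> 2 * real m * ln (real m) * (real m / real m powr (2 + s)) < s"
    using eventually_ge_at_top[of N] by eventually_elim simp
  then obtain m0 where m0: "\<And>m. m0 \<le> m \<Longrightarrow> N \<le> m"
    "\<And>m. m0 \<le> m \<Longrightarrow> 2 * real m * ln (real m) * (real m / real m powr (2 + s)) < s"
    unfolding eventually_sequentially by blast

  \<comment> \<open>The bound \<open>m0\<close> is independent of \<open>\<omega>\<close>,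
    \<open>\<alpha>\<close> and \<open>\<beta>\<close>, which makes the approximation
    uniform.\<close>
  have bad_A: "\<omega> \<in> A m"
    if \<omega>: "\<omega> \<in> space M" and bad: "\<forall>n\<ge>N. 1 + 2 * s < real n * ln (real n) * prod_dist \<alpha> \<beta> n \<omega>"
      and m: "m0 \<le> m" for \<omega> \<alpha> \<beta> m
  proof -
    have Nm: "N \<le> m" "1 \<le> m" using m0(1)[OF m] assms by auto
    have powr_pos: "0 < real m powr (2 + s)" using Nm by simp
    then have K: "0 < K m" "real m powr (2 + s) \<le> real (K m)"
      unfolding K_def by linarith+
    define \<eta> where "\<eta> = real m * (1 / real (K m))"
    have \<eta>: "0 \<le> \<eta>" "\<eta> \<le> real m / real m powr (2 + s)"
      using divide_left_mono[OF K(2), of "real m"] K(1) powr_pos by (simp_all add: \<eta>_def)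
    have "real m \<le> real m powr (2 + s)"
      using Nm assms powr_mono[of 1 "2 + s" "real m"] by simp
    then have \<eta>1: "\<eta> \<le> 1" using \<eta>(2) powr_pos by (meson divide_le_eq_1_pos order.trans)
    obtain i k where i: "i < K m" "\<bar>\<alpha> - real_of_int k - real i / real (K m)\<bar> \<le> 1 / real (K m)"
      using grid_approx[OF K(1)] by blast
    obtain j l where j: "j < K m" "\<bar>\<beta> - real_of_int l - real j / real (K m)\<bar> \<le> 1 / real (K m)"
      using grid_approx[OF K(1)] by blast
    let ?a = "real i / real (K m)" and ?b = "real j / real (K m)"
    have "\<omega> \<in> G ?a ?b n" if n: "n \<in> {N..m}" for n
    proof -
      have n1: "N \<le> n" "n \<le> m" "1 \<le> n" using n assms by auto
      have ln_n: "ln (real N) \<le> ln (real n)" "ln (real n) \<le> ln (real m)"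
        using n1 assms by auto
      have ln_pos: "0 < ln (real n)" by (rule less_le_trans[OF lnN ln_n(1)])
      then have pos: "0 < real n * ln (real n)" using n1(3) by (intro mult_pos_pos) auto
      have ln_m: "0 \<le> ln (real m)" using ln_pos ln_n(2) by (meson less_imp_le order_trans)
      let ?x = "nint_dist (real n * ?a - \<gamma> n \<omega>)" and ?y = "nint_dist (real n * ?b - \<delta> n \<omega>)"
      have "prod_dist \<alpha> \<beta> n \<omega> \<le> (?x + \<eta>) * (?y + \<eta>)"
        unfolding prod_dist_def \<eta>_def using i(2) j(2) n1
        by (intro mult_mono nint_dist_multiple_le) auto
      also have "\<dots> = prod_dist ?a ?b n \<omega> + \<eta> * (?x + ?y + \<eta>)"
        by (simp add: prod_dist_def algebra_simps)
      \<comment> \<open>Each distance is at most 1/2 and \<open>\<eta> \<le> 1\<close>; this is the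
        source of the factor 2 in the choice of \<open>m0\<close>.\<close>
      also have "\<eta> * (?x + ?y + \<eta>) \<le> \<eta> * 2"
        using nint_dist_le_half[of "real n * ?a - \<gamma> n \<omega>"] nint_dist_le_half[of "real n * ?b - \<delta> n \<omega>"] \<eta> \<eta>1
        by (intro mult_left_mono) auto
      finally have le: "prod_dist \<alpha> \<beta> n \<omega> \<le> prod_dist ?a ?b n \<omega> + \<eta> * 2" by simp
      have "real n * ln (real n) * (\<eta> * 2) \<le> real m * ln (real m) * (real m / real m powr (2 + s) * 2)"
        using n1(2) ln_n(2) less_imp_le[OF ln_pos] ln_m \<eta> by (intro mult_mono mult_nonneg_nonneg) simp_all
      also have "\<dots> < s" using m0(2)[OF m] by (simp add: mult_ac)
      finally have "real n * ln (real n) * (\<eta> * 2) < s" .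
      moreover have "1 + 2 * s < real n * ln (real n) * prod_dist \<alpha> \<beta> n \<omega>"
        using bad n1 by blast
      moreover have "real n * ln (real n) * prod_dist \<alpha> \<beta> n \<omega>
          \<le> real n * ln (real n) * prod_dist ?a ?b n \<omega> + real n * ln (real n) * (\<eta> * 2)"
        using mult_left_mono[OF le less_imp_le[OF pos]] by (simp only: distrib_left)
      ultimately have "1 + s < real n * ln (real n) * prod_dist ?a ?b n \<omega>" by linarith
      then show ?thesis
        using pos \<omega> by (simp add: G_def pos_divide_less_eq mult.commute)
    qed
    then show ?thesis using i(1) j(1) unfolding A_def by blast
  qed

  \<comment> \<open>The outcomes admitting a bad pair form an uncountable union over
    \<open>\<alpha>\<close> and \<open>\<beta>\<close>, so measurability is not claimed for them;
    they are only enclosed in the measurable set \<open>Z\<close>, which is null since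
    \<open>prob (A m)\<close> tends to 0.\<close>
  define Z where "Z = (\<Inter>m\<in>{m0..}. A m)"
  have Z_sets: "Z \<in> events"
    unfolding Z_def using A_sets m0(1) by (intro sets.countable_INT') auto
  have "prob Z \<le> 0"
  proof (rule tendsto_lowerbound[OF lim_A])
    show "\<forall>\<^sub>F m in sequentially. prob Z \<le> prob (A m)"
      using eventually_ge_at_top[of m0]
    proof eventually_elim
      case (elim m)
      then show ?case
        using A_sets[OF m0(1)[OF elim]] by (intro finite_measure_mono) (auto simp: Z_def)
    qed
  qed simp
  then have "Z \<in> null_sets M"
    using Z_sets by (auto simp: null_sets_def emeasure_eq_measure measure_le_0_iff)
  then show ?thesis
    by (rule AE_I') (use bad_A in \<open>auto simp: Z_def\<close>)
qed

end

theorem theorem1: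
  fixes M :: "'a measure" and \<gamma> \<delta> :: "nat \<Rightarrow> 'a \<Rightarrow> real"
  assumes "prob_space M"
    and "prob_space.indep_vars M (\<lambda>_. borel) (case_sum \<gamma> \<delta>) ({1..} <+> {1..})"
    and "\<And>n. n \<ge> 1 \<Longrightarrow> distr M borel (\<gamma> n) = uniform_measure lborel {0..<1}"
    and "\<And>n. n \<ge> 1 \<Longrightarrow> distr M borel (\<delta> n) = uniform_measure lborel {0..<1}"
  shows "AE \<omega> in M. \<forall>\<alpha> \<beta> :: real.
    liminf (\<lambda>n. ereal (real n * ln (real n) *
      nint_dist (real n * \<alpha> - \<gamma> n \<omega>) * nint_dist (real n * \<beta> - \<delta> n \<omega>))) \<le> 1"
proof -
  interpret uniform_shifts M \<gamma> \<delta>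
    using assms by (simp add: uniform_shifts_def uniform_shifts_axioms_def)
  define s where "s k = 1 / real (Suc k)" for k
  \<comment> \<open>Only \<open>k\<close> and \<open>N\<close> range outside the almost sure
    statement, and they are countable. The reals \<open>\<alpha>\<close> and \<open>\<beta>\<close>
    are already quantified inside it, so one null set serves all of them.\<close>
  have "AE \<omega> in M. \<forall>k N. 1 \<le> N \<longrightarrow> 4 * (1 + s k) \<le> ln (real N) \<longrightarrow>
      \<not> (\<exists>\<alpha> \<beta>. \<forall>n\<ge>N. 1 + 2 * s k < real n * ln (real n) * prod_dist \<alpha> \<beta> n \<omega>)"
    unfolding AE_all_countable
    by (intro allI AE_impI AE_no_uniformly_bad_pair) (simp_all add: s_def)
  then show ?thesis
  proof eventually_elim
    case (elim \<omega>)
    show ?case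
    proof (intro allI, rule ccontr)
      fix \<alpha> \<beta>
      let ?f = "\<lambda>n. real n * ln (real n) * prod_dist \<alpha> \<beta> n \<omega>"
      assume "\<not> liminf (\<lambda>n. ereal (real n * ln (real n) *
        nint_dist (real n * \<alpha> - \<gamma> n \<omega>) * nint_dist (real n * \<beta> - \<delta> n \<omega>))) \<le> 1"
      then have "ereal 1 < liminf (\<lambda>n. ereal (?f n))"
        by (simp add: prod_dist_def mult.assoc not_le one_ereal_def)
      \<comment> \<open>The liminf may be infinite, so a real \<open>c\<close> strictly between it
        and 1 is used; \<open>k\<close> is then taken so large that
        \<open>1 + 2 * s k < c\<close>.\<close>
      then obtain c where c': "ereal 1 < ereal c" "ereal c < liminf (\<lambda>n. ereal (?f n))"
        by (blast dest: ereal_dense2)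
      then have c: "1 < c" by simp
      obtain k where k: "inverse (real (Suc k)) < (c - 1) / 2"
        using reals_Archimedean[of "(c - 1) / 2"] c by auto
      have "\<forall>\<^sub>F n in sequentially. ereal c < ereal (?f n)"
        by (rule less_LiminfD[OF c'(2)])
      moreover have "\<forall>\<^sub>F n in sequentially. 4 * (1 + s k) \<le> ln (real n)"
        by real_asymp
      ultimately have "\<forall>\<^sub>F n in sequentially. c < ?f n \<and> 1 \<le> n \<and> 4 * (1 + s k) \<le> ln (real n)"
        using eventually_ge_at_top[of 1] by eventually_elim simp
      then obtain N where N: "\<And>n. N \<le> n \<Longrightarrow> c < ?f n \<and> 1 \<le> n \<and> 4 * (1 + s k) \<le> ln (real n)"
        unfolding eventually_sequentially by blast
      have "1 + 2 * s k < c" using k by (simp add: s_def inverse_eq_divide)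
      then have "\<forall>n\<ge>N. 1 + 2 * s k < ?f n" using N by force
      then show False using elim N[OF order.refl] by blast
    qed
  qed
qed

end
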